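(* Let $G\in\mathcal{A}$ be any algorithm in the class $\mathcal{A}$ of asynchronous randomized incremental algorithms (defined in the context), let $(\sigma,L_1,\dots,L_n,n)$ be any parameter set for the unconstrained minimization problem, and let $k\in\mathbb{N}$. Then there are a dimension $d$, a corresponding function $f$ on $\mathbb{R}^d$ (that is $\sigma$-strongly convex with Lipschitz gradient and block-coordinate-wise Lipschitz constants $L_1,\dots,L_n$), with minimizer $x_*$, and a starting point $x_0$, such that the iterates of $G$ satisfy $$\frac{\mathbb{E}\|x_k-x_*\|^2}{\|x_0-x_*\|^2}\ge\frac12\left(1-\frac{4}{\sum_{i=1}^n\sqrt{L_i/\sigma}+2n}\right)^k.$$ Hence the complexity $K(\epsilon)$ of every algorithm in $\mathcal{A}$ satisfies $$K(\epsilon)\ge\frac14(1+o(1))\left(\sum_{i=1}^n\sqrt{L_i/\sigma}+2n\right)\ln\frac{1}{2\epsilon}.$$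
   Context: Problem: $\min_{x\in\mathbb{R}^d}f(x)$, where $x=(x_{(1)},\dots,x_{(n)})$ is split into $n$ coordinate blocks, $\nabla f=(\nabla_1f,\dots,\nabla_nf)$, $f$ is $\sigma$-strongly convex ($\sigma>0$) with Lipschitz gradient, and $\|\nabla_if(x+P_ih)-\nabla_if(x)\|\le L_i\|h\|$ for all $x,h$, with $P_i$ the projection onto block $i$. $\nabla_if(x)$ is regarded as a vector in $\mathbb{R}^d$ supported on block $i$. For a subset $X\subset\mathbb{R}^d$, $\mathrm{IC}(X)$ (inconsistent reads) is the set of vectors $v=(v_{1,1},v_{2,2},\dots,v_{d,d})$ for some $v_1,\dots,v_d\in X$, where $v_{i,j}$ is the $j$-th component of $v_i$. For iterates $x_0,x_1,\dots$ let $X_k=\{x_0,\dots,x_k\}$. Class $\mathcal{A}$: algorithms $G$ on this problem such that (1) for each parameter set $(\sigma,L_1,\dots,L_n,n)$, $G$ has an associated IID sequence of random indices $i_k\in\{1,\dots,n\}$ with some fixed distribution $\mathbb{P}[i_k=i]=p_i$, $\sum_{i=1}^np_i=1$; (2) for all $k\ge0$ the iterates satisfy $$x_{k+1}\in\mathrm{span}\{\mathrm{IC}(X_k),\nabla_{i_0}f(\mathrm{IC}(X_0)),\nabla_{i_1}f(\mathrm{IC}(X_1)),\dots,\nabla_{i_k}f(\mathrm{IC}(X_k))\},$$ where $\nabla_{i}f(\mathrm{IC}(X))=\{\nabla_if(v):v\in\mathrm{IC}(X)\}$. The complexity $K(\epsilon)$ is the number of iterations $K$ needed to guarantee $\mathbb{E}\|x_K-x_*\|^2\le\epsilon\|x_0-x_*\|^2$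 for all such $f$ (in any dimension) and all $x_0$, for the given parameter set. The $o(1)$ is with respect to $\sum_{i=1}^n\sqrt{L_i/\sigma}+2n\to\infty$.
   Formalization: The error bound is not claimed for n=1, L_1<3σ and even k>0, where 1−4/(√(L_1/σ)+2) is negative; for n=1, L_1=σ, k=2 the English bound fails, since one gradient step reaches x_*. Parameter sets have L_i≥σ, as existence of f forces. *)

theory Defs
  imports
    "HOL-Probability.Probability"
    "HOL-Analysis.Finite_Function_Topology"
    "HOL-Library.Landau_Symbols"
begin

text \<open>
  The dimension is quantified inside the statements, so \<open>\<real>\<^sup>d\<close> is the subspace \<open>euclid d\<close> of the
  finitely supported sequences. The library makes this type a real vector space whose
  \<^const>\<open>norm\<close> is the 1-norm; the Euclidean norm is therefore introduced as \<open>l2norm\<close>. The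
  library norm enters only through differentiability, which is the same for all norms
  on \<open>\<real>\<^sup>d\<close>. Components and blocks are numbered from 0.
\<close>

type_synonym rvec = "nat \<Rightarrow>\<^sub>0 real"

definition euclid :: "nat \<Rightarrow> rvec set" where
  "euclid d = {x. Poly_Mapping.keys x \<subseteq> {..<d}}"

definition dot :: "rvec \<Rightarrow> rvec \<Rightarrow> real" where
  "dot x y = (\<Sum>j\<in>Poly_Mapping.keys x. Poly_Mapping.lookup x j * Poly_Mapping.lookup y j)"

definition l2norm :: "rvec \<Rightarrow> real" where
  "l2norm x = L2_set (Poly_Mapping.lookup x) (Poly_Mapping.keys x)"

definition grad :: "nat \<Rightarrow> (rvec \<Rightarrow> real) \<Rightarrow> rvec \<Rightarrow> rvec" where
  "grad d f x =
     (\<Sum>j<d. Poly_Mapping.single j (deriv (\<lambda>t. f (x + Poly_Mapping.single j t)) 0))"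

text \<open>
  A block structure is given by the list \<open>ds\<close> of the block sizes; the dimension is \<open>sum_list ds\<close>.
\<close>

definition block :: "nat list \<Rightarrow> nat \<Rightarrow> nat set" where
  "block ds i = {sum_list (take i ds)..<sum_list (take (Suc i) ds)}"

definition proj :: "nat list \<Rightarrow> nat \<Rightarrow> rvec \<Rightarrow> rvec" where
  "proj ds i x = (\<Sum>j\<in>block ds i. Poly_Mapping.single j (Poly_Mapping.lookup x j))"

definition block_grad :: "nat list \<Rightarrow> (rvec \<Rightarrow> real) \<Rightarrow> nat \<Rightarrow> rvec \<Rightarrow> rvec" where
  "block_grad ds f i x = proj ds i (grad (sum_list ds) f x)"

definition strongly_convex :: "nat \<Rightarrow> real \<Rightarrow> (rvec \<Rightarrow> real) \<Rightarrow> bool" where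
  "strongly_convex d \<sigma> f \<longleftrightarrow>
     (\<forall>x\<in>euclid d. \<forall>y\<in>euclid d.
        f y \<ge> f x + dot (grad d f x) (y - x) + \<sigma> / 2 * (l2norm (y - x))\<^sup>2)"

text \<open>
  The constants \<open>L\<^sub>1, \<dots>, L\<^sub>n\<close> form the list \<open>L\<close>, so that \<open>n = length L\<close>. Since blocks are nonempty,
  \<open>\<sigma> \<le> L\<^sub>i\<close> is necessary for a \<open>\<sigma>\<close>-strongly convex function with these constants to exist.
\<close>

definition parameter_set :: "real \<Rightarrow> real list \<Rightarrow> bool" where
  "parameter_set \<sigma> L \<longleftrightarrow> 0 < \<sigma> \<and> L \<noteq> [] \<and> (\<forall>l\<in>set L. \<sigma> \<le> l)"

definition problem :: "real \<Rightarrow> real list \<Rightarrow> nat list \<Rightarrow> (rvec \<Rightarrow> real) \<Rightarrow> bool" where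
  "problem \<sigma> L ds f \<longleftrightarrow>
     length ds = length L \<and> (\<forall>m\<in>set ds. 0 < m) \<and>
     f differentiable_on euclid (sum_list ds) \<and>
     strongly_convex (sum_list ds) \<sigma> f \<and>
     (\<exists>C. \<forall>x\<in>euclid (sum_list ds). \<forall>y\<in>euclid (sum_list ds).
        l2norm (grad (sum_list ds) f x - grad (sum_list ds) f y) \<le> C * l2norm (x - y)) \<and>
     (\<forall>i<length L. \<forall>x\<in>euclid (sum_list ds). \<forall>h\<in>euclid (sum_list ds).
        l2norm (block_grad ds f i (x + proj ds i h) - block_grad ds f i x) \<le> L ! i * l2norm h)"

definition inconsistent_reads :: "nat \<Rightarrow> rvec set \<Rightarrow> rvec set" where
  "inconsistent_reads d X =
     {\<Sum>j<d. Poly_Mapping.single j (Poly_Mapping.lookup (v j) j) | v. \<forall>j<d. v j \<in> X}"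

text \<open>
  The index sequence and the space it lives on depend only on the parameter set. The
  iterates may depend on the problem and the starting point in any way, and on further
  randomness of the space, e.g. on random delays.
\<close>

record 'w algorithm =
  prob_of :: "real \<Rightarrow> real list \<Rightarrow> 'w measure"
  index :: "real \<Rightarrow> real list \<Rightarrow> nat \<Rightarrow> 'w \<Rightarrow> nat"
  iterate :: "real \<Rightarrow> real list \<Rightarrow> nat list \<Rightarrow> (rvec \<Rightarrow> real) \<Rightarrow> rvec \<Rightarrow> nat \<Rightarrow> 'w \<Rightarrow> rvec"

definition iid_indices :: "'w measure \<Rightarrow> nat \<Rightarrow> (nat \<Rightarrow> 'w \<Rightarrow> nat) \<Rightarrow> bool" where
  "iid_indices M n I \<longleftrightarrow>
     prob_space.indep_vars M (\<lambda>_. count_space {..<n}) I UNIV \<and>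
     (\<exists>p. (\<Sum>i<n. p i) = 1 \<and> (\<forall>k. \<forall>i<n. measure M {\<omega>\<in>space M. I k \<omega> = i} = p i))"

definition incremental_step ::
    "nat list \<Rightarrow> (rvec \<Rightarrow> real) \<Rightarrow> (nat \<Rightarrow> nat) \<Rightarrow> (nat \<Rightarrow> rvec) \<Rightarrow> nat \<Rightarrow> bool" where
  "incremental_step ds f i x k \<longleftrightarrow>
     x (Suc k) \<in> span (inconsistent_reads (sum_list ds) (x ` {..k}) \<union>
       (\<Union>j\<le>k. block_grad ds f (i j) ` inconsistent_reads (sum_list ds) (x ` {..j})))"

definition random_vectors :: "'w measure \<Rightarrow> nat \<Rightarrow> (nat \<Rightarrow> 'w \<Rightarrow> rvec) \<Rightarrow> bool" where
  "random_vectors M d X \<longleftrightarrow>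
     (\<forall>k. (\<forall>\<omega>\<in>space M. X k \<omega> \<in> euclid d) \<and>
          (\<forall>j<d. (\<lambda>\<omega>. Poly_Mapping.lookup (X k \<omega>) j) \<in> borel_measurable M))"

definition async_incremental :: "'w algorithm set" where
  "async_incremental = {G. \<forall>\<sigma> L. parameter_set \<sigma> L \<longrightarrow>
     prob_space (prob_of G \<sigma> L) \<and>
     iid_indices (prob_of G \<sigma> L) (length L) (index G \<sigma> L) \<and>
     (\<forall>ds f x0. problem \<sigma> L ds f \<longrightarrow> x0 \<in> euclid (sum_list ds) \<longrightarrow>
        random_vectors (prob_of G \<sigma> L) (sum_list ds) (iterate G \<sigma> L ds f x0) \<and>
        (\<forall>\<omega>\<in>space (prob_of G \<sigma> L). iterate G \<sigma> L ds f x0 0 \<omega> = x0) \<and>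
        (AE \<omega> in prob_of G \<sigma> L. \<forall>k.
           incremental_step ds f (\<lambda>j. index G \<sigma> L j \<omega>) (\<lambda>j. iterate G \<sigma> L ds f x0 j \<omega>) k))}"

definition mean_sq_error ::
    "'w algorithm \<Rightarrow> real \<Rightarrow> real list \<Rightarrow> nat list \<Rightarrow> (rvec \<Rightarrow> real) \<Rightarrow> rvec \<Rightarrow> rvec \<Rightarrow> nat \<Rightarrow> ennreal"
  where
  "mean_sq_error G \<sigma> L ds f x0 xs k =
     (\<integral>\<^sup>+\<omega>. ennreal ((l2norm (iterate G \<sigma> L ds f x0 k \<omega> - xs))\<^sup>2) \<partial>prob_of G \<sigma> L)"

text \<open>The value is \<^term>\<open>\<infinity> :: enat\<close> if no number of iterations suffices.\<close>

definition complexity :: "'w algorithm \<Rightarrow> real \<Rightarrow> real list \<Rightarrow> real \<Rightarrow> enat" where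
  "complexity G \<sigma> L \<epsilon> =
     (INF K\<in>{K. \<forall>ds f xs x0. problem \<sigma> L ds f \<longrightarrow> is_arg_min f (\<lambda>x. x \<in> euclid (sum_list ds)) xs \<longrightarrow>
                  x0 \<in> euclid (sum_list ds) \<longrightarrow>
                  mean_sq_error G \<sigma> L ds f x0 xs K \<le> ennreal (\<epsilon> * (l2norm (x0 - xs))\<^sup>2)}. enat K)"

definition cond_sum :: "real \<Rightarrow> real list \<Rightarrow> real" where
  "cond_sum \<sigma> L = (\<Sum>i<length L. sqrt (L ! i / \<sigma>)) + 2 * real (length L)"

text \<open>
  The number \<open>1 - 4 / cond_sum \<sigma> L\<close> is negative exactly if \<open>n = 1\<close> and \<open>L\<^sub>1 < 4 \<sigma>\<close>. Its even powers are
  then not a lower bound in general: for \<open>n = 1\<close> and \<open>L\<^sub>1 = \<sigma>\<close>, every admissible \<open>f\<close> is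
  \<open>\<sigma>/2 \<parallel>x - x\<^sub>*\<parallel>\<^sup>2\<close> up to a constant, and one gradient step reaches \<open>x\<^sub>*\<close>. For \<open>n = 1\<close> the
  tridiagonal worst-case quadratic gives \<open>((\<surd>\<kappa> - 1) / (\<surd>\<kappa> + 1))\<^bsup>2k\<^esup>\<close> with \<open>\<kappa> = L\<^sub>1 / \<sigma>\<close>, which is at
  least \<open>\<bar>1 - 4 / (\<surd>\<kappa> + 2)\<bar>\<^bsup>k\<^esup>\<close> (for \<open>k > 0\<close>) exactly if \<open>\<kappa> \<ge> 3\<close>. Hence the positive even
  powers are left out when \<open>n = 1\<close> and \<open>L\<^sub>1 < 3 \<sigma>\<close>.
\<close>

definition sign_degenerate :: "real \<Rightarrow> real list \<Rightarrow> nat \<Rightarrow> bool" where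
  "sign_degenerate \<sigma> L k \<longleftrightarrow> length L = 1 \<and> L ! 0 < 3 * \<sigma> \<and> even k \<and> 0 < k"

end

theory Submission
  imports Defs "HOL-Real_Asymp.Real_Asymp"
begin

text \<open>
  The hard objective is a quadratic that is nontrivial in one block \<open>s\<close> only. There it is
  Nesterov's worst-case function: its Hessian is \<open>\<sigma>\<close> times the identity plus \<open>(L\<^sub>s - \<sigma>) / 4\<close> times
  a second difference matrix, and its minimizer is the geometric sequence \<open>1, q, q\<^sup>2, \<dots>\<close>
  with \<open>q = (\<surd>\<kappa> - 1) / (\<surd>\<kappa> + 1)\<close>, \<open>\<kappa> = L\<^sub>s / \<sigma>\<close>. The Hessian is diagonally dominant, so that
  \<open>quadratic_problem\<close> reads off strong convexity and the Lipschitz constants from its row sums.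

  Since the Hessian is tridiagonal, a block gradient at a point supported on the first \<open>r\<close>
  coordinates of the chain is supported on the first \<open>r + 1\<close> if the block is \<open>s\<close>, and adds
  nothing to the chain otherwise. Inconsistent reads respect this, because it is a condition on
  single coordinates. Starting from 0, the iterate \<open>x\<^sub>k\<close> hence has at most \<open>N\<close> nonzero coordinates
  on the chain, where \<open>N\<close> counts the draws of \<open>s\<close> among the first \<open>k\<close> indices
  (\<open>iterate_supported_below\<close>), whatever else the algorithm does. The missing tail carries the
  fraction \<open>q\<^bsup>2N\<^esup>\<close> of the initial squared error, up to a factor \<open>1 / 2\<close> for the finite length of
  the chain (\<open>geometric_tail_ge_half\<close>). The indices are independent, so \<open>q\<^bsup>2N\<^esup>\<close> has expectation
  \<open>(1 - p\<^sub>s (1 - q\<^sup>2))\<^bsup>k\<^esup>\<close> (\<open>nn_integral_power_count\<close>, \<open>block_lower_bound\<close>).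

  The adversary knows the distribution of the indices and chooses \<open>s\<close>. As \<open>1 - q\<^sup>2 \<le> 4 / (\<surd>\<kappa> + 2)\<close>,
  an averaging argument yields a block with \<open>p\<^sub>s (1 - q\<^sup>2) \<le> 4 / S\<close>, where \<open>S\<close> is the sum in the
  theorem (\<open>exists_slow_block\<close>). The complexity bound follows by taking logarithms and
  \<open>- ln (1 - 4 / S) \<sim> 4 / S\<close>.
\<close>

abbreviation lookup :: "rvec \<Rightarrow> nat \<Rightarrow> real" where
  "lookup \<equiv> Poly_Mapping.lookup"

section \<open>Coordinates of finitely supported sequences\<close>

lemma lookup_sum_single:
  "finite A \<Longrightarrow> lookup (\<Sum>j\<in>A. Poly_Mapping.single j (c j)) i = (if i \<in> A then c i else 0)"
  by (simp add: lookup_sum lookup_single when_def)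

lemma lookup_scaleR: "lookup (r *\<^sub>R x) j = r * lookup (x :: rvec) j"
proof -
  have "finite {i. r * lookup x i \<noteq> 0}"
    by (rule finite_subset[of _ "Poly_Mapping.keys x"]) (auto simp: in_keys_iff)
  then show ?thesis
    by (simp add: scaleR_poly_mapping_def)
qed

lemma euclid_iff: "x \<in> euclid d \<longleftrightarrow> (\<forall>j\<ge>d. lookup x j = 0)"
  unfolding euclid_def by (auto simp: in_keys_iff subset_iff) (meson not_le)

lemma euclid_diff: "x \<in> euclid d \<Longrightarrow> y \<in> euclid d \<Longrightarrow> x - y \<in> euclid d"
  by (simp add: euclid_iff lookup_minus)

lemma l2norm_sq:
  assumes "x \<in> euclid d"
  shows "(l2norm x)\<^sup>2 = (\<Sum>j<d. (lookup x j)\<^sup>2)"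
proof -
  have "(l2norm x)\<^sup>2 = (\<Sum>j\<in>Poly_Mapping.keys x. (lookup x j)\<^sup>2)"
    by (simp add: l2norm_def L2_set_def sum_nonneg)
  also have "\<dots> = (\<Sum>j<d. (lookup x j)\<^sup>2)"
    using assms by (intro sum.mono_neutral_left) (auto simp: euclid_def in_keys_iff)
  finally show ?thesis .
qed

lemma l2norm_nonneg: "0 \<le> l2norm x"
  by (simp add: l2norm_def L2_set_nonneg)

lemma dot_euclid:
  assumes "x \<in> euclid d"
  shows "dot x y = (\<Sum>j<d. lookup x j * lookup y j)"
  unfolding dot_def using assms
  by (intro sum.mono_neutral_left) (auto simp: euclid_def in_keys_iff)

lemma bounded_linear_lookup: "bounded_linear (\<lambda>x :: rvec. lookup x j)"
proof (rule bounded_linear_intro[where K = 1])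
  fix x :: rvec
  show "norm (lookup x j) \<le> norm x * 1"
  proof (cases "j \<in> Poly_Mapping.keys x")
    case True
    then show ?thesis
      by (auto simp: norm_poly_mapping_def dist_poly_mapping_def
          intro!: member_le_sum[of j _ "\<lambda>j. \<bar>lookup x j\<bar>"])
  qed (simp add: in_keys_iff)
qed (simp_all add: lookup_add lookup_scaleR)

lemma lookup_grad:
  "lookup (grad d f x) j = (if j < d then deriv (\<lambda>t. f (x + Poly_Mapping.single j t)) 0 else 0)"
  by (simp add: grad_def lookup_sum_single)

lemma grad_in_euclid: "grad d f x \<in> euclid d"
  by (simp add: euclid_iff lookup_grad)

lemma lookup_proj: "lookup (proj ds i x) j = (if j \<in> block ds i then lookup x j else 0)"
  by (simp add: proj_def lookup_sum_single block_def)

lemma sum_list_take_mono: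
  fixes ds :: "nat list"
  assumes "i \<le> j"
  shows "sum_list (take i ds) \<le> sum_list (take j ds)"
proof -
  have "take j ds = take i ds @ take (j - i) (drop i ds)"
    using assms by (metis le_add_diff_inverse take_add)
  then show ?thesis by simp
qed

lemma block_subset: "block ds i \<subseteq> {..<sum_list ds}"
proof -
  have "sum_list (take (Suc i) ds) \<le> sum_list ds"
    using sum_list_take_mono[of "Suc i" "max (Suc i) (length ds)" ds] by simp
  then show ?thesis by (auto simp: block_def)
qed

lemma blocks_disjoint:
  assumes "i \<noteq> j"
  shows "block ds i \<inter> block ds j = {}"
proof -
  have "block ds i \<inter> block ds j = {}" if "i < j" for i j
    using sum_list_take_mono[of "Suc i" j ds] that by (auto simp: block_def)
  then show ?thesis
    using assms by (metis Int_commute nat_neq_iff)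
qed

lemma proj_in_euclid: "proj ds i x \<in> euclid (sum_list ds)"
  using block_subset[of ds i] by (auto simp: euclid_iff lookup_proj)

section \<open>Quadratic objectives\<close>

definition quadratic :: "nat \<Rightarrow> (nat \<Rightarrow> nat \<Rightarrow> real) \<Rightarrow> rvec \<Rightarrow> rvec \<Rightarrow> real" where
  "quadratic d A c x =
     (\<Sum>i<d. \<Sum>j<d. A i j * (lookup x i - lookup c i) * (lookup x j - lookup c j)) / 2"

lemma quadratic_add:
  assumes sym: "\<And>i j. A i j = A j i"
  shows "quadratic d A c (x + h) = quadratic d A c x
    + (\<Sum>i<d. (\<Sum>j<d. A i j * (lookup x j - lookup c j)) * lookup h i)
    + (\<Sum>i<d. \<Sum>j<d. A i j * lookup h i * lookup h j) / 2"
proof -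
  let ?w = "\<lambda>j. lookup x j - lookup c j" and ?h = "lookup h"
  have swap: "(\<Sum>i<d. \<Sum>j<d. A i j * ?w i * ?h j) = (\<Sum>i<d. \<Sum>j<d. A i j * ?w j * ?h i)"
    by (subst sum.swap) (simp add: sym)
  have "(\<Sum>i<d. \<Sum>j<d. A i j * (?w i + ?h i) * (?w j + ?h j))
      = (\<Sum>i<d. \<Sum>j<d. A i j * ?w i * ?w j) + (\<Sum>i<d. \<Sum>j<d. A i j * ?w i * ?h j)
        + (\<Sum>i<d. \<Sum>j<d. A i j * ?w j * ?h i) + (\<Sum>i<d. \<Sum>j<d. A i j * ?h i * ?h j)"
    unfolding sum.distrib[symmetric] by (intro sum.cong refl) (simp add: algebra_simps)
  moreover have "lookup (x + h) i - lookup c i = ?w i + ?h i" for i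
    by (simp add: lookup_add)
  ultimately show ?thesis
    unfolding quadratic_def by (simp only: swap sum_distrib_right add_divide_distrib)
qed

lemma lookup_grad_quadratic:
  assumes sym: "\<And>i j. A i j = A j i" and "j < d"
  shows "lookup (grad d (quadratic d A c) x) j = (\<Sum>l<d. A j l * (lookup x l - lookup c l))"
proof -
  let ?g = "\<Sum>l<d. A j l * (lookup x l - lookup c l)"
  have lin: "(\<Sum>i<d. G i * lookup (Poly_Mapping.single j t) i) = G j * t" for G :: "nat \<Rightarrow> real" and t
  proof -
    have "(\<Sum>i<d. G i * lookup (Poly_Mapping.single j t) i) = (\<Sum>i<d. if i = j then G j * t else 0)"
      by (intro sum.cong) (auto simp: lookup_single)
    then show ?thesis using \<open>j < d\<close> by simp
  qed
  have quad: "(\<Sum>i<d. \<Sum>l<d. A i l * lookup (Poly_Mapping.single j t) i * lookup (Poly_Mapping.single j t) l)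
      = A j j * t\<^sup>2" for t
  proof -
    have "(\<Sum>i<d. \<Sum>l<d. A i l * lookup (Poly_Mapping.single j t) i * lookup (Poly_Mapping.single j t) l)
        = (\<Sum>i<d. A i j * lookup (Poly_Mapping.single j t) i * t)"
      by (simp only: lin)
    also have "\<dots> = (\<Sum>i<d. (A i j * t) * lookup (Poly_Mapping.single j t) i)"
      by (simp add: ac_simps)
    also have "\<dots> = A j j * t * t" by (rule lin)
    finally show ?thesis by (simp add: power2_eq_square)
  qed
  have "(\<lambda>t. quadratic d A c (x + Poly_Mapping.single j t))
      = (\<lambda>t. quadratic d A c x + ?g * t + A j j * t\<^sup>2 / 2)"
    by (simp only: quadratic_add[OF sym] quad) (simp only: lin)
  moreover have "((\<lambda>t. quadratic d A c x + ?g * t + A j j * t\<^sup>2 / 2) has_real_derivative ?g) (at 0)"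
    by (auto intro!: derivative_eq_intros)
  ultimately have "deriv (\<lambda>t. quadratic d A c (x + Poly_Mapping.single j t)) 0 = ?g"
    by (metis DERIV_imp_deriv)
  then show ?thesis using \<open>j < d\<close> by (simp add: lookup_grad)
qed

lemma quadratic_differentiable: "quadratic d A c differentiable_on S"
proof -
  have [simp]: "(\<lambda>x :: rvec. lookup x j) differentiable F" for j F
    by (rule bounded_linear_imp_differentiable[OF bounded_linear_lookup])
  show ?thesis
    unfolding differentiable_on_def quadratic_def[abs_def] divide_inverse by auto
qed

text \<open>
  Gershgorin's theorem, lower bound: pairing \<open>A i j * u i * u j\<close> with
  \<open>\<bar>A i j\<bar> * (u i\<^sup>2 + u j\<^sup>2) / 2\<close> leaves only the diagonal. The row condition says that the diagonal
  entry exceeds the sum of the other absolute values of its row by at least \<open>\<sigma>\<close>.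
\<close>

lemma diagonally_dominant_form_ge:
  fixes A :: "nat \<Rightarrow> nat \<Rightarrow> real"
  assumes sym: "\<And>i j. A i j = A j i"
    and dom: "\<And>i. i < d \<Longrightarrow> \<sigma> + (\<Sum>j<d. \<bar>A i j\<bar>) \<le> 2 * A i i"
  shows "\<sigma> * (\<Sum>i<d. (u i)\<^sup>2) \<le> (\<Sum>i<d. \<Sum>j<d. A i j * u i * u j)"
proof -
  let ?R = "\<lambda>i. \<Sum>j<d. \<bar>A i j\<bar>"
  have "(\<Sum>i<d. \<Sum>j<d. \<bar>A i j\<bar> * (u j)\<^sup>2) = (\<Sum>i<d. \<Sum>j<d. \<bar>A i j\<bar> * (u i)\<^sup>2)"
    by (subst sum.swap) (simp add: sym)
  then have R: "(\<Sum>i<d. ?R i * (u i)\<^sup>2) = (\<Sum>i<d. \<Sum>j<d. \<bar>A i j\<bar> * ((u i)\<^sup>2 + (u j)\<^sup>2) / 2)"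
    by (simp add: sum_distrib_right sum.distrib distrib_left add_divide_distrib
        flip: sum_divide_distrib)
  have "(\<Sum>i<d. 2 * A i i * (u i)\<^sup>2) = (\<Sum>i<d. \<Sum>j<d. if j = i then 2 * A i i * (u i)\<^sup>2 else 0)"
    by simp
  also have "\<dots> \<le> (\<Sum>i<d. \<Sum>j<d. A i j * u i * u j + \<bar>A i j\<bar> * ((u i)\<^sup>2 + (u j)\<^sup>2) / 2)"
  proof (intro sum_mono)
    fix i j
    show "(if j = i then 2 * A i i * (u i)\<^sup>2 else 0)
        \<le> A i j * u i * u j + \<bar>A i j\<bar> * ((u i)\<^sup>2 + (u j)\<^sup>2) / 2"
    proof (cases "j = i")
      case True
      have "A i i * (u i)\<^sup>2 \<le> \<bar>A i i\<bar> * (u i)\<^sup>2"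
        by (intro mult_right_mono) auto
      with True show ?thesis by (simp add: power2_eq_square ac_simps)
    next
      case False
      have "2 * \<bar>u i * u j\<bar> \<le> (u i)\<^sup>2 + (u j)\<^sup>2"
        using sum_squares_bound[of "\<bar>u i\<bar>" "\<bar>u j\<bar>"] by (simp add: abs_mult)
      then have "\<bar>A i j\<bar> * \<bar>u i * u j\<bar> \<le> \<bar>A i j\<bar> * (((u i)\<^sup>2 + (u j)\<^sup>2) / 2)"
        by (intro mult_left_mono) auto
      moreover have "- (A i j * u i * u j) \<le> \<bar>A i j\<bar> * \<bar>u i * u j\<bar>"
        by (metis abs_ge_minus_self abs_mult mult.assoc)
      ultimately show ?thesis using False by simp
    qed
  qed
  also have "\<dots> = (\<Sum>i<d. \<Sum>j<d. A i j * u i * u j) + (\<Sum>i<d. ?R i * (u i)\<^sup>2)"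
    by (simp only: R sum.distrib)
  finally have "(\<Sum>i<d. (2 * A i i - ?R i) * (u i)\<^sup>2) \<le> (\<Sum>i<d. \<Sum>j<d. A i j * u i * u j)"
    by (simp add: left_diff_distrib sum_subtractf)
  moreover have "\<sigma> * (\<Sum>i<d. (u i)\<^sup>2) \<le> (\<Sum>i<d. (2 * A i i - ?R i) * (u i)\<^sup>2)"
    unfolding sum_distrib_left using dom by (intro sum_mono mult_right_mono) (auto simp: le_diff_eq)
  ultimately show ?thesis by linarith
qed

text \<open>
  Schur's test: by the Cauchy-Schwarz inequality with weights \<open>\<bar>A i j\<bar>\<close>, the absolute row sums of
  a symmetric matrix bound its operator norm.
\<close>

lemma schur_test:
  fixes A :: "nat \<Rightarrow> nat \<Rightarrow> real"
  assumes sym: "\<And>i j. A i j = A j i"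
    and row: "\<And>i. i \<in> S \<Longrightarrow> (\<Sum>j\<in>S. \<bar>A i j\<bar>) \<le> R"
  shows "(\<Sum>i\<in>S. (\<Sum>j\<in>S. A i j * u j)\<^sup>2) \<le> R\<^sup>2 * (\<Sum>j\<in>S. (u j)\<^sup>2)"
proof (cases "S = {}")
  case False
  then obtain i0 where "i0 \<in> S" by auto
  have "0 \<le> (\<Sum>j\<in>S. \<bar>A i0 j\<bar>)" by (simp add: sum_nonneg)
  with row[OF \<open>i0 \<in> S\<close>] have "0 \<le> R" by linarith
  have "(\<Sum>i\<in>S. (\<Sum>j\<in>S. A i j * u j)\<^sup>2) \<le> (\<Sum>i\<in>S. R * (\<Sum>j\<in>S. \<bar>A i j\<bar> * (u j)\<^sup>2))"
  proof (intro sum_mono)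
    fix i assume "i \<in> S"
    have "(\<Sum>j\<in>S. A i j * u j)\<^sup>2 = (\<Sum>j\<in>S. sgn (A i j) * sqrt \<bar>A i j\<bar> * (sqrt \<bar>A i j\<bar> * u j))\<^sup>2"
      by (simp add: mult.assoc sgn_mult_abs flip: real_sqrt_mult)
        (simp add: sgn_mult_abs flip: mult.assoc)
    also have "\<dots> \<le> (\<Sum>j\<in>S. (sgn (A i j) * sqrt \<bar>A i j\<bar>)\<^sup>2) * (\<Sum>j\<in>S. (sqrt \<bar>A i j\<bar> * u j)\<^sup>2)"
      by (rule Cauchy_Schwarz_ineq_sum)
    also have "\<dots> = (\<Sum>j\<in>S. \<bar>A i j\<bar>) * (\<Sum>j\<in>S. \<bar>A i j\<bar> * (u j)\<^sup>2)"
      by (intro arg_cong2[where f = "(*)"] sum.cong refl)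
        (auto simp: power_mult_distrib sgn_if)
    also have "\<dots> \<le> R * (\<Sum>j\<in>S. \<bar>A i j\<bar> * (u j)\<^sup>2)"
      using row[OF \<open>i \<in> S\<close>] by (intro mult_right_mono) (auto intro: sum_nonneg)
    finally show "(\<Sum>j\<in>S. A i j * u j)\<^sup>2 \<le> R * (\<Sum>j\<in>S. \<bar>A i j\<bar> * (u j)\<^sup>2)" .
  qed
  also have "\<dots> = R * (\<Sum>j\<in>S. (\<Sum>i\<in>S. \<bar>A j i\<bar>) * (u j)\<^sup>2)"
    unfolding sum_distrib_left[symmetric] sum_distrib_right
    by (subst sum.swap) (simp add: sym)
  also have "\<dots> \<le> R * (\<Sum>j\<in>S. R * (u j)\<^sup>2)"
    using row \<open>0 \<le> R\<close> by (intro mult_left_mono sum_mono mult_right_mono) auto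
  finally show ?thesis
    by (simp add: sum_distrib_left power2_eq_square mult.assoc)
qed simp

text \<open>
  Row sums thus decide all requirements at once: a lower Gershgorin bound gives strong convexity,
  and an upper one within a block gives the Lipschitz constant of the block.
\<close>

proposition quadratic_problem:
  assumes len: "length ds = length L" and pos: "\<forall>m\<in>set ds. 0 < m"
    and sym: "\<And>i j. A i j = A j i"
    and lower: "\<And>i. i < sum_list ds \<Longrightarrow> \<sigma> + (\<Sum>j<sum_list ds. \<bar>A i j\<bar>) \<le> 2 * A i i"
    and upper: "\<And>b i. b < length L \<Longrightarrow> i \<in> block ds b \<Longrightarrow> (\<Sum>j\<in>block ds b. \<bar>A i j\<bar>) \<le> L ! b"
    and L_nonneg: "\<And>l. l \<in> set L \<Longrightarrow> 0 \<le> l"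
  shows "problem \<sigma> L ds (quadratic (sum_list ds) A c)"
proof -
  define d where "d = sum_list ds"
  let ?f = "quadratic d A c"
  note g = lookup_grad_quadratic[OF sym]
  have "strongly_convex d \<sigma> ?f"
    unfolding strongly_convex_def
  proof (intro ballI)
    fix x y assume xy: "x \<in> euclid d" "y \<in> euclid d"
    define h where "h = y - x"
    have h: "h \<in> euclid d" "y = x + h" using xy by (auto simp: h_def euclid_diff)
    have "\<sigma> / 2 * (l2norm h)\<^sup>2 \<le> (\<Sum>i<d. \<Sum>j<d. A i j * lookup h i * lookup h j) / 2"
      using diagonally_dominant_form_ge[of A d \<sigma> "lookup h"] sym lower
      by (simp add: l2norm_sq[OF h(1)] d_def)
    moreover have "dot (grad d ?f x) h
        = (\<Sum>i<d. (\<Sum>j<d. A i j * (lookup x j - lookup c j)) * lookup h i)"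
      by (simp add: dot_euclid[OF grad_in_euclid] g)
    ultimately show "?f x + dot (grad d ?f x) (y - x) + \<sigma> / 2 * (l2norm (y - x))\<^sup>2 \<le> ?f y"
      by (simp add: h(2) quadratic_add[OF sym])
  qed
  moreover have "\<exists>C. \<forall>x\<in>euclid d. \<forall>y\<in>euclid d.
      l2norm (grad d ?f x - grad d ?f y) \<le> C * l2norm (x - y)"
  proof (intro exI ballI)
    fix x y assume xy: "x \<in> euclid d" "y \<in> euclid d"
    let ?C = "\<Sum>i<d. \<Sum>j<d. \<bar>A i j\<bar>"
    have "(l2norm (grad d ?f x - grad d ?f y))\<^sup>2 = (\<Sum>i<d. (\<Sum>j<d. A i j * lookup (x - y) j)\<^sup>2)"
      unfolding l2norm_sq[OF euclid_diff[OF grad_in_euclid grad_in_euclid]]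
      by (intro sum.cong) (auto simp: g lookup_minus algebra_simps simp flip: sum_subtractf)
    also have "\<dots> \<le> ?C\<^sup>2 * (l2norm (x - y))\<^sup>2"
      unfolding l2norm_sq[OF euclid_diff[OF xy]]
      by (rule schur_test[OF sym]) (auto intro!: member_le_sum[of _ _ "\<lambda>i. \<Sum>j<d. \<bar>A i j\<bar>"] sum_nonneg)
    finally show "l2norm (grad d ?f x - grad d ?f y) \<le> ?C * l2norm (x - y)"
      unfolding power_mult_distrib[symmetric]
      by (rule power2_le_imp_le) (intro mult_nonneg_nonneg sum_nonneg l2norm_nonneg abs_ge_zero)
  qed
  moreover have "l2norm (block_grad ds ?f b (x + proj ds b h) - block_grad ds ?f b x) \<le> L ! b * l2norm h"
    if b: "b < length L" and xh: "x \<in> euclid d" "h \<in> euclid d" for b x h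
  proof -
    let ?B = "block ds b"
    have B: "?B \<subseteq> {..<d}" by (simp add: d_def block_subset)
    have in_d: "block_grad ds ?f b y \<in> euclid d" for y
      by (simp add: block_grad_def d_def proj_in_euclid)
    have diff: "lookup (block_grad ds ?f b (x + proj ds b h) - block_grad ds ?f b x) j
        = (if j \<in> ?B then \<Sum>l\<in>?B. A j l * lookup h l else 0)" for j
    proof (cases "j \<in> ?B")
      case True
      then have "j < d" using B by auto
      have "(\<Sum>l<d. A j l * lookup (proj ds b h) l) = (\<Sum>l\<in>?B. A j l * lookup h l)"
        using B by (intro sum.mono_neutral_cong_right) (auto simp: lookup_proj)
      with True \<open>j < d\<close> show ?thesis
        by (simp add: block_grad_def lookup_minus lookup_proj g lookup_add algebra_simps
            sum.distrib sum_subtractf flip: d_def)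
    qed (simp add: block_grad_def lookup_minus lookup_proj)
    have "(l2norm (block_grad ds ?f b (x + proj ds b h) - block_grad ds ?f b x))\<^sup>2
        = (\<Sum>j\<in>?B. (\<Sum>l\<in>?B. A j l * lookup h l)\<^sup>2)"
      unfolding l2norm_sq[OF euclid_diff[OF in_d in_d]] diff
      using B by (intro sum.mono_neutral_cong_right) auto
    also have "\<dots> \<le> (L ! b)\<^sup>2 * (\<Sum>j\<in>?B. (lookup h j)\<^sup>2)"
      by (rule schur_test[OF sym upper[OF b]])
    also have "\<dots> \<le> (L ! b)\<^sup>2 * (l2norm h)\<^sup>2"
      unfolding l2norm_sq[OF xh(2)] using B by (intro mult_left_mono sum_mono2) auto
    finally show ?thesis
      unfolding power_mult_distrib[symmetric]
      by (rule power2_le_imp_le) (simp add: L_nonneg b l2norm_nonneg)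
  qed
  ultimately show ?thesis
    using len pos by (auto simp: problem_def quadratic_differentiable simp flip: d_def)
qed

lemma quadratic_minimizer:
  assumes sym: "\<And>i j. A i j = A j i" and "0 \<le> \<sigma>"
    and lower: "\<And>i. i < d \<Longrightarrow> \<sigma> + (\<Sum>j<d. \<bar>A i j\<bar>) \<le> 2 * A i i"
    and "c \<in> euclid d"
  shows "is_arg_min (quadratic d A c) (\<lambda>x. x \<in> euclid d) c"
proof -
  have "0 \<le> quadratic d A c x" for x
  proof -
    have "0 \<le> \<sigma> * (\<Sum>i<d. (lookup x i - lookup c i)\<^sup>2)"
      using \<open>0 \<le> \<sigma>\<close> by (simp add: sum_nonneg)
    also have "\<dots> \<le> (\<Sum>i<d. \<Sum>j<d. A i j * (lookup x i - lookup c i) * (lookup x j - lookup c j))"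
      by (rule diagonally_dominant_form_ge[OF sym lower])
    finally show ?thesis by (simp add: quadratic_def)
  qed
  moreover have "quadratic d A c c = 0" by (simp add: quadratic_def)
  ultimately show ?thesis
    using \<open>c \<in> euclid d\<close> by (auto simp: is_arg_min_def not_less)
qed

section \<open>The chain quadratic of a single block\<close>

text \<open>
  On the coordinates \<open>{s..<s + m}\<close> this is \<open>\<sigma>\<close> times the identity plus \<open>a\<close> times the second difference
  matrix, elsewhere only \<open>\<sigma>\<close> times the identity. The last diagonal entry of the second difference
  matrix is lowered by \<open>q\<close>: this acts like a further coordinate equal to \<open>q\<close> times the last one, so
  that the minimizer is an exact finite geometric sequence rather than a truncated infinite one.
\<close>

definition chain_hessian :: "real \<Rightarrow> real \<Rightarrow> real \<Rightarrow> nat \<Rightarrow> nat \<Rightarrow> nat \<Rightarrow> nat \<Rightarrow> real" where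
  "chain_hessian \<sigma> a q s m i j =
     (if i = j then \<sigma> + (if i \<in> {s..<s + m} then (if Suc i = s + m then 2 - q else 2) * a else 0)
      else if i \<in> {s..<s + m} \<and> j \<in> {s..<s + m} \<and> (i = Suc j \<or> j = Suc i) then - a else 0)"

definition chain_solution :: "real \<Rightarrow> nat \<Rightarrow> nat \<Rightarrow> rvec" where
  "chain_solution q s m = (\<Sum>j\<in>{s..<s + m}. Poly_Mapping.single j (q ^ (j - s)))"

abbreviation chain_objective :: "nat \<Rightarrow> real \<Rightarrow> real \<Rightarrow> real \<Rightarrow> nat \<Rightarrow> nat \<Rightarrow> rvec \<Rightarrow> real" where
  "chain_objective d \<sigma> a q s m \<equiv> quadratic d (chain_hessian \<sigma> a q s m) (chain_solution q s m)"

lemma chain_hessian_sym: "chain_hessian \<sigma> a q s m i j = chain_hessian \<sigma> a q s m j i"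
  by (auto simp: chain_hessian_def)

lemma lookup_chain_solution:
  "lookup (chain_solution q s m) j = (if j \<in> {s..<s + m} then q ^ (j - s) else 0)"
  unfolding chain_solution_def by (rule lookup_sum_single) simp

lemma chain_solution_in_euclid: "s + m \<le> d \<Longrightarrow> chain_solution q s m \<in> euclid d"
  by (auto simp: euclid_iff lookup_chain_solution)

lemma chain_row_sum_le:
  assumes "finite T" "0 \<le> \<sigma>" "0 \<le> a" "q \<le> 1" "i \<in> {s..<s + m}"
  shows "(\<Sum>j\<in>T. \<bar>chain_hessian \<sigma> a q s m i j\<bar>)
    \<le> chain_hessian \<sigma> a q s m i i + a + (if Suc i < s + m then a else 0)"
proof -
  let ?A = "chain_hessian \<sigma> a q s m"
  have diag: "0 \<le> ?A i i"
    using assms by (auto simp: chain_hessian_def intro!: add_nonneg_nonneg mult_nonneg_nonneg)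
  \<comment> \<open>For \<open>i = 0\<close> the truncated index \<open>i - 1\<close> is \<open>i\<close> itself, which only enlarges the bound.\<close>
  have "(\<Sum>j\<in>T. \<bar>?A i j\<bar>) \<le> (\<Sum>j\<in>T. (if j = i then ?A i i else 0) + (if j = i - 1 then a else 0)
      + (if j = Suc i then if Suc i < s + m then a else 0 else 0))"
    using assms diag by (intro sum_mono) (auto simp: chain_hessian_def)
  also have "\<dots> \<le> ?A i i + a + (if Suc i < s + m then a else 0)"
    using assms diag by (auto simp: sum.distrib)
  finally show ?thesis .
qed

lemma chain_diagonally_dominant:
  assumes "0 \<le> \<sigma>" "0 \<le> a" "q \<le> 1"
  shows "\<sigma> + (\<Sum>j<d. \<bar>chain_hessian \<sigma> a q s m i j\<bar>) \<le> 2 * chain_hessian \<sigma> a q s m i i"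
proof (cases "i \<in> {s..<s + m}")
  case True
  have "q * a \<le> a" using assms mult_right_mono[of q 1 a] by simp
  then show ?thesis
    using chain_row_sum_le[OF _ assms True, of "{..<d}"] True
    by (auto simp: chain_hessian_def[of _ _ _ _ _ i i] algebra_simps split: if_splits)
next
  case False
  then have "(\<Sum>j<d. \<bar>chain_hessian \<sigma> a q s m i j\<bar>) = (\<Sum>j<d. if j = i then \<sigma> else 0)"
    using assms by (intro sum.cong) (auto simp: chain_hessian_def)
  also have "\<dots> \<le> \<sigma>"
    using assms by simp
  finally show ?thesis
    using False by (auto simp: chain_hessian_def[of _ _ _ _ _ i i])
qed

definition chain_blocks :: "nat \<Rightarrow> nat \<Rightarrow> nat \<Rightarrow> nat list" where
  "chain_blocks n s m = replicate s 1 @ m # replicate (n - Suc s) 1"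

lemma block_chain_blocks: "block (chain_blocks n s m) s = {s..<s + m}"
  by (simp add: block_def chain_blocks_def sum_list_replicate)

lemma sum_list_chain_blocks: "sum_list (chain_blocks n s m) = s + m + (n - Suc s)"
  by (simp add: chain_blocks_def sum_list_replicate)

lemma chain_problem:
  assumes params: "parameter_set \<sigma> L" and s: "s < length L" and "0 < m" "0 \<le> q" "q \<le> 1"
    and a: "a = (L ! s - \<sigma>) / 4"
  defines "ds \<equiv> chain_blocks (length L) s m"
  shows "problem \<sigma> L ds (chain_objective (sum_list ds) \<sigma> a q s m)"
proof (rule quadratic_problem)
  have "0 < \<sigma>" and \<sigma>_le: "\<sigma> \<le> L ! b" if "b < length L" for b
    using params that by (auto simp: parameter_set_def)
  then have "0 < \<sigma>" "0 \<le> a" using s by (auto simp: a)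
  then show "\<sigma> + (\<Sum>j<sum_list ds. \<bar>chain_hessian \<sigma> a q s m i j\<bar>) \<le> 2 * chain_hessian \<sigma> a q s m i i" for i
    using assms by (intro chain_diagonally_dominant) auto
  show "length ds = length L" "\<forall>m\<in>set ds. 0 < m"
    using s \<open>0 < m\<close> by (auto simp: ds_def chain_blocks_def)
  show "0 \<le> l" if "l \<in> set L" for l
    using params that by (auto simp: parameter_set_def)
  show "(\<Sum>j\<in>block ds b. \<bar>chain_hessian \<sigma> a q s m i j\<bar>) \<le> L ! b"
    if b: "b < length L" "i \<in> block ds b" for b i
  proof (cases "b = s")
    case True
    then have i: "i \<in> {s..<s + m}" using b by (simp add: ds_def block_chain_blocks)
    have "0 \<le> q * a" using \<open>0 \<le> q\<close> \<open>0 \<le> a\<close> by simp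
    moreover have "L ! s = \<sigma> + 4 * a" by (simp add: a field_simps)
    ultimately show ?thesis
      using chain_row_sum_le[of "block ds b" \<sigma> a q i s m] i \<open>0 < \<sigma>\<close> \<open>0 \<le> a\<close> \<open>q \<le> 1\<close> True
      by (auto simp: chain_hessian_def[of _ _ _ _ _ i i] block_def algebra_simps split: if_splits)
  next
    case False
    then have i: "i \<notin> {s..<s + m}"
      using b blocks_disjoint[OF False, of ds] by (auto simp: ds_def block_chain_blocks)
    have "(\<Sum>j\<in>block ds b. \<bar>chain_hessian \<sigma> a q s m i j\<bar>) = (\<Sum>j\<in>block ds b. if j = i then \<sigma> else 0)"
      using i \<open>0 < \<sigma>\<close> by (intro sum.cong) (auto simp: chain_hessian_def)
    also have "\<dots> = \<sigma>" using b by (simp add: block_def)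
    finally show ?thesis using \<sigma>_le b by simp
  qed
qed (rule chain_hessian_sym)

text \<open>
  Beyond the first coordinate of the chain, the linear term of the objective vanishes, because
  \<open>q\<close> is a root of \<open>a * q\<^sup>2 - (\<sigma> + 2 * a) * q + a\<close>. What is left couples each coordinate only to its
  neighbours, so that the gradient reaches at most one coordinate further than the point.
\<close>

lemma chain_gradient_vanishes:
  assumes root: "a * (1 - q)\<^sup>2 = \<sigma> * q" and "s + m \<le> d" and i: "s < i" "i < s + m"
    and zero: "\<And>j. i - 1 \<le> j \<Longrightarrow> j < s + m \<Longrightarrow> lookup v j = 0"
  shows "lookup (grad d (chain_objective d \<sigma> a q s m) v) i = 0"
proof -
  let ?A = "chain_hessian \<sigma> a q s m"
  define w where "w j = lookup v j - lookup (chain_solution q s m) j" for j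
  obtain r where r: "i = s + Suc r"
    using i(1) by (metis add_Suc_right less_iff_Suc_add)
  have w: "w (s + j) = - (q ^ j)" if "r \<le> j" "j < m" for j
    using that zero[of "s + j"] r by (simp add: w_def lookup_chain_solution)
  have "lookup (grad d (chain_objective d \<sigma> a q s m) v) i = (\<Sum>l<d. ?A i l * w l)"
    unfolding w_def using assms by (intro lookup_grad_quadratic chain_hessian_sym) auto
  also have "\<dots> = (\<Sum>l\<in>{s + r, s + Suc r} \<union>
      (if Suc (Suc r) < m then {s + Suc (Suc r)} else {}). ?A i l * w l)"
    using assms(2) i r by (intro sum.mono_neutral_right) (auto simp: chain_hessian_def)
  \<comment> \<open>In the last row the lowered diagonal entry stands in for the missing term with \<open>q ^ Suc (Suc r)\<close>.\<close>
  also have "\<dots> = - (q ^ r * ((\<sigma> + 2 * a) * q - a - a * q\<^sup>2))"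
  proof (cases "Suc (Suc r) < m")
    case True
    then show ?thesis
      using r w[of r] w[of "Suc r"] w[of "Suc (Suc r)"]
      by (simp add: chain_hessian_def algebra_simps power2_eq_square)
  next
    case False
    with i r have "m = Suc (Suc r)" by simp
    then show ?thesis
      using r w[of r] w[of "Suc r"]
      by (simp add: chain_hessian_def algebra_simps power2_eq_square)
  qed
  also have "(\<sigma> + 2 * a) * q - a - a * q\<^sup>2 = \<sigma> * q - a * (1 - q)\<^sup>2"
    by (simp add: power2_eq_square algebra_simps)
  finally show ?thesis by (simp add: root)
qed

section \<open>How many coordinates an iterate can reach\<close>

definition supported_below :: "nat \<Rightarrow> nat \<Rightarrow> nat \<Rightarrow> rvec set" where
  "supported_below s m r = {x. \<forall>j. r \<le> j \<longrightarrow> j < m \<longrightarrow> lookup x (s + j) = 0}"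

lemma subspace_supported_below: "subspace (supported_below s m r)"
  by (auto simp: subspace_def supported_below_def lookup_add lookup_scaleR)

lemma supported_below_mono: "r \<le> r' \<Longrightarrow> supported_below s m r \<subseteq> supported_below s m r'"
  by (auto simp: supported_below_def)

text \<open>Whether a vector lies in the set is decided coordinate by coordinate.\<close>

lemma inconsistent_reads_supported_below:
  assumes "X \<subseteq> supported_below s m r"
  shows "inconsistent_reads d X \<subseteq> supported_below s m r"
  using assms by (auto simp: inconsistent_reads_def supported_below_def lookup_sum_single subset_iff)

lemma block_grad_supported_below:
  fixes n :: nat
  assumes root: "a * (1 - q)\<^sup>2 = \<sigma> * q" and v: "v \<in> supported_below s m r"
  defines "ds \<equiv> chain_blocks n s m"
  shows "block_grad ds (chain_objective (sum_list ds) \<sigma> a q s m) b v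
    \<in> supported_below s m (if b = s then Suc r else r)"
proof (cases "b = s")
  case True
  have "lookup (grad (sum_list ds) (chain_objective (sum_list ds) \<sigma> a q s m) v) (s + j) = 0"
    if j: "Suc r \<le> j" "j < m" for j
  proof (rule chain_gradient_vanishes[OF root])
    show "lookup v l = 0" if "s + j - 1 \<le> l" "l < s + m" for l
      using v that j by (auto simp: supported_below_def dest!: spec[of _ "l - s"])
  qed (use j in \<open>auto simp: ds_def sum_list_chain_blocks\<close>)
  then show ?thesis
    using True by (simp add: supported_below_def block_grad_def lookup_proj)
next
  case False
  then show ?thesis
    using blocks_disjoint[OF False, of ds]
    by (auto simp: supported_below_def block_grad_def lookup_proj ds_def block_chain_blocks)
qed

text \<open>
  Each draw of block \<open>s\<close> reveals at most one more coordinate of the chain; draws of other blocks,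
  inconsistent reads and linear combinations reveal none.
\<close>

lemma iterate_supported_below:
  fixes x :: "nat \<Rightarrow> rvec"
  assumes root: "a * (1 - q)\<^sup>2 = \<sigma> * q" and "x 0 = 0"
    and step: "\<And>k. incremental_step (chain_blocks n s m)
      (chain_objective (sum_list (chain_blocks n s m)) \<sigma> a q s m) i x k"
  shows "x k \<in> supported_below s m (card {l. l < k \<and> i l = s})"
proof (induction k rule: less_induct)
  case (less k)
  define ds where "ds = chain_blocks n s m"
  let ?N = "\<lambda>k. card {l. l < k \<and> i l = s}"
  have mono: "?N j \<le> ?N k" if "j \<le> k" for j k
    using that by (intro card_mono) auto
  show ?case
  proof (cases k)
    case 0
    then show ?thesis using \<open>x 0 = 0\<close> by (simp add: supported_below_def)
  next
    case (Suc k')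
    have reads: "inconsistent_reads (sum_list ds) (x ` {..j}) \<subseteq> supported_below s m (?N j)"
      if "j \<le> k'" for j
    proof (rule inconsistent_reads_supported_below, rule image_subsetI)
      fix l assume "l \<in> {..j}"
      then show "x l \<in> supported_below s m (?N j)"
        using less[of l] mono[of l j] supported_below_mono[of "?N l" "?N j" s m] that Suc by auto
    qed
    have grads: "block_grad ds (chain_objective (sum_list ds) \<sigma> a q s m) (i j) v \<in> supported_below s m (?N k)"
      if j: "j \<le> k'" and v: "v \<in> inconsistent_reads (sum_list ds) (x ` {..j})" for j v
    proof -
      have "{l. l < Suc j \<and> i l = s} = {l. l < j \<and> i l = s} \<union> (if i j = s then {j} else {})"
        by (auto simp: less_Suc_eq)
      then have "?N (Suc j) = (if i j = s then Suc (?N j) else ?N j)"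
        by simp
      then show ?thesis
        using block_grad_supported_below[OF root subsetD[OF reads[OF j] v], of n "i j"]
          mono[of "Suc j" k] supported_below_mono[of "?N (Suc j)" "?N k" s m] j Suc
        by (auto simp: ds_def)
    qed
    have "x k \<in> span (inconsistent_reads (sum_list ds) (x ` {..k'}) \<union>
        (\<Union>j\<le>k'. block_grad ds (chain_objective (sum_list ds) \<sigma> a q s m) (i j) `
          inconsistent_reads (sum_list ds) (x ` {..j})))"
      using step[of k'] Suc by (simp add: incremental_step_def ds_def)
    also have "\<dots> \<subseteq> supported_below s m (?N k)"
      using reads[of k'] supported_below_mono[OF mono[of k' k]] grads Suc
      by (intro span_minimal subspace_supported_below) auto
    finally show ?thesis .
  qed
qed

section \<open>The error of an iterate\<close>

lemma l2norm_chain_solution: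
  assumes "s + m \<le> d"
  shows "(l2norm (0 - chain_solution q s m))\<^sup>2 = (\<Sum>j<m. (q\<^sup>2) ^ j)"
proof -
  have "0 - chain_solution q s m \<in> euclid d"
    using assms by (auto simp: euclid_iff lookup_minus lookup_chain_solution)
  then have "(l2norm (0 - chain_solution q s m))\<^sup>2 = (\<Sum>j<d. (lookup (chain_solution q s m) j)\<^sup>2)"
    by (simp add: l2norm_sq lookup_minus)
  also have "\<dots> = (\<Sum>j\<in>{s..<s + m}. (q\<^sup>2) ^ (j - s))"
    using assms by (intro sum.mono_neutral_cong_right) 
      (auto simp: lookup_chain_solution power2_eq_square power_mult_distrib)
  also have "\<dots> = (\<Sum>j<m. (q\<^sup>2) ^ j)"
    by (rule sum.reindex_bij_witness[of _ "\<lambda>j. s + j" "\<lambda>j. j - s"]) auto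
  finally show ?thesis .
qed

lemma chain_error_ge:
  assumes "s + m \<le> d" "x \<in> euclid d" "x \<in> supported_below s m r"
  shows "(\<Sum>j\<in>{r..<m}. (q\<^sup>2) ^ j) \<le> (l2norm (x - chain_solution q s m))\<^sup>2"
proof -
  let ?e = "x - chain_solution q s m"
  have "(\<Sum>j\<in>{r..<m}. (q\<^sup>2) ^ j) = (\<Sum>j\<in>{s + r..<s + m}. (lookup ?e j)\<^sup>2)"
  proof (rule sum.reindex_bij_witness[of _ "\<lambda>j. j - s" "\<lambda>j. s + j"])
    fix j assume "j \<in> {r..<m}"
    then have "lookup x (s + j) = 0" using assms(3) by (simp add: supported_below_def)
    then show "(lookup ?e (s + j))\<^sup>2 = (q\<^sup>2) ^ j"
      using \<open>j \<in> {r..<m}\<close>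
      by (simp add: lookup_minus lookup_chain_solution power2_eq_square power_mult_distrib)
  qed auto
  also have "\<dots> \<le> (\<Sum>j<d. (lookup ?e j)\<^sup>2)"
    using assms(1) by (intro sum_mono2) auto
  also have "\<dots> = (l2norm ?e)\<^sup>2"
    using assms by (intro l2norm_sq[symmetric] euclid_diff chain_solution_in_euclid)
  finally show ?thesis .
qed

text \<open>
  The fraction of the squared norm beyond coordinate \<open>N\<close> would be exactly \<open>r ^ N\<close> for an infinite
  chain. A chain of length \<open>m\<close> loses at most half of it once \<open>r ^ (m - k) \<le> 1 / 2\<close>.
\<close>

lemma geometric_tail_ge_half:
  fixes r :: real
  assumes "0 \<le> r" "r < 1" "N \<le> k" "k < m" "2 * r ^ (m - k) \<le> 1"
  shows "r ^ N * (\<Sum>j<m. r ^ j) \<le> 2 * (\<Sum>j\<in>{N..<m}. r ^ j)"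
proof -
  have geom: "(1 - r) * (\<Sum>j<n. r ^ j) = 1 - r ^ n" for n
    by (simp add: one_diff_power_eq)
  have "2 * r ^ (m - N) \<le> 2 * r ^ (m - k)"
    using assms by (intro mult_left_mono power_decreasing) auto
  with assms(5) have "2 * r ^ (m - N) \<le> 1" by (rule order_trans[rotated])
  then have "1 \<le> 2 * (1 - r ^ (m - N))" by (simp add: right_diff_distrib)
  moreover have "1 - r ^ m \<le> 1" using assms by simp
  ultimately have "1 - r ^ m \<le> 2 * (1 - r ^ (m - N))" by (rule order_trans[rotated])
  then have "(1 - r) * (\<Sum>j<m. r ^ j) \<le> (1 - r) * (2 * (\<Sum>j<m - N. r ^ j))"
    by (simp only: geom mult.left_commute[of "1 - r" 2])
  then have "(\<Sum>j<m. r ^ j) \<le> 2 * (\<Sum>j<m - N. r ^ j)"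
    using assms by simp
  then have "r ^ N * (\<Sum>j<m. r ^ j) \<le> r ^ N * (2 * (\<Sum>j<m - N. r ^ j))"
    using assms by (intro mult_left_mono) auto
  also have "r ^ N * (2 * (\<Sum>j<m - N. r ^ j)) = 2 * (\<Sum>j<m - N. r ^ (N + j))"
    by (simp add: power_add sum_distrib_left mult.left_commute)
  also have "(\<Sum>j<m - N. r ^ (N + j)) = (\<Sum>j\<in>{N..<m}. r ^ j)"
    by (rule sum.reindex_bij_witness[of _ "\<lambda>j. j - N" "\<lambda>j. N + j"]) auto
  finally show ?thesis .
qed

text \<open>By independence, the expectation is a product of \<open>k\<close> factors \<open>p * r + (1 - p)\<close>.\<close>

lemma (in prob_space) nn_integral_power_count:
  fixes I :: "nat \<Rightarrow> 'a \<Rightarrow> nat"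
  assumes indep: "indep_vars (\<lambda>_. count_space {..<n}) I UNIV" and "s < n"
    and p: "\<And>l. prob {\<omega> \<in> space M. I l \<omega> = s} = p" and "0 \<le> r"
  shows "(\<integral>\<^sup>+\<omega>. ennreal (r ^ card {l. l < k \<and> I l \<omega> = s}) \<partial>M) = ennreal ((1 - p * (1 - r)) ^ k)"
proof -
  define Y where "Y l \<omega> = ennreal (if I l \<omega> = s then r else 1)" for l \<omega>
  have "indep_vars (\<lambda>_. borel) (\<lambda>l \<omega>. (\<lambda>i. ennreal (if i = s then r else 1)) (I l \<omega>)) {..<k}"
    by (rule indep_vars_compose2[OF indep_vars_subset[OF indep]]) auto
  then have Y_indep: "indep_vars (\<lambda>_. borel) Y {..<k}"
    by (simp add: Y_def[abs_def])
  have Y_int: "(\<integral>\<^sup>+\<omega>. Y l \<omega> \<partial>M) = ennreal (1 - p * (1 - r))" for l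
  proof -
    let ?A = "{\<omega> \<in> space M. I l \<omega> = s}"
    have I_meas: "I l \<in> measurable M (count_space {..<n})"
      using indep by (simp add: indep_vars_def)
    have "I l -` {s} \<inter> space M \<in> sets M"
      by (rule measurable_sets[OF I_meas]) (use \<open>s < n\<close> in auto)
    moreover have "?A = I l -` {s} \<inter> space M" by auto
    ultimately have A: "?A \<in> sets M" by simp
    have "(\<integral>\<^sup>+\<omega>. Y l \<omega> \<partial>M) = (\<integral>\<^sup>+\<omega>. ennreal r * indicator ?A \<omega> + indicator (space M - ?A) \<omega> \<partial>M)"
      by (intro nn_integral_cong) (auto simp: Y_def)
    also have "\<dots> = ennreal r * emeasure M ?A + emeasure M (space M - ?A)"
      using A by (subst nn_integral_add) (auto simp: nn_integral_cmult)
    also have "\<dots> = ennreal r * ennreal p + ennreal (1 - p)"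
      using A p[of l] by (simp add: emeasure_eq_measure prob_compl)
    also have "\<dots> = ennreal (r * p + (1 - p))"
      using p[of l] measure_nonneg[of M ?A] prob_le_1[of ?A] \<open>0 \<le> r\<close>
      by (simp add: ennreal_mult ennreal_plus)
    finally show ?thesis by (simp add: algebra_simps)
  qed
  have "ennreal (r ^ card {l. l < k \<and> I l \<omega> = s}) = (\<Prod>l<k. Y l \<omega>)" for \<omega>
  proof (induction k)
    case (Suc k)
    have "{l. l < Suc k \<and> I l \<omega> = s} = {l. l < k \<and> I l \<omega> = s} \<union> (if I k \<omega> = s then {k} else {})"
      by (auto simp: less_Suc_eq)
    then have "card {l. l < Suc k \<and> I l \<omega> = s}
        = card {l. l < k \<and> I l \<omega> = s} + (if I k \<omega> = s then 1 else 0)"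
      by simp
    then have "r ^ card {l. l < Suc k \<and> I l \<omega> = s}
        = r ^ card {l. l < k \<and> I l \<omega> = s} * (if I k \<omega> = s then r else 1)"
      by (simp add: power_add)
    then show ?case
      using Suc \<open>0 \<le> r\<close> by (simp add: Y_def ennreal_mult)
  qed simp
  then have "(\<integral>\<^sup>+\<omega>. ennreal (r ^ card {l. l < k \<and> I l \<omega> = s}) \<partial>M) = (\<Prod>l<k. \<integral>\<^sup>+\<omega>. Y l \<omega> \<partial>M)"
    using indep_vars_nn_integral[OF _ Y_indep] by simp
  moreover have "0 \<le> 1 - p * (1 - r)"
  proof -
    have "0 \<le> p" "p \<le> 1" using p[of 0] measure_nonneg prob_le_1 by metis+
    moreover from \<open>0 \<le> p\<close> have "0 \<le> p * r" using \<open>0 \<le> r\<close> by simp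
    ultimately show ?thesis by (simp add: right_diff_distrib)
  qed
  ultimately show ?thesis by (simp add: Y_int ennreal_power)
qed

section \<open>The lower bound for one block\<close>

definition chain_ratio :: "real \<Rightarrow> real" where
  "chain_ratio \<kappa> = (sqrt \<kappa> - 1) / (sqrt \<kappa> + 1)"

lemma chain_ratio_bounds:
  assumes "1 \<le> \<kappa>"
  shows "0 \<le> chain_ratio \<kappa>" "chain_ratio \<kappa> < 1"
  using assms by (auto simp: chain_ratio_def divide_simps real_sqrt_ge_one add_pos_nonneg)

lemma chain_ratio_root:
  assumes "0 < \<sigma>" "\<sigma> \<le> l"
  shows "(l - \<sigma>) / 4 * (1 - chain_ratio (l / \<sigma>))\<^sup>2 = \<sigma> * chain_ratio (l / \<sigma>)"
proof -
  define t where "t = sqrt (l / \<sigma>)"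
  have "0 \<le> t" using assms by (simp add: t_def)
  have "t\<^sup>2 = l / \<sigma>" using assms by (simp add: t_def)
  then have l: "l = \<sigma> * t\<^sup>2" using assms by (simp add: field_simps)
  have "1 - chain_ratio (l / \<sigma>) = 2 / (t + 1)"
    using \<open>0 \<le> t\<close> by (simp add: chain_ratio_def flip: t_def) (simp add: field_simps)
  then have "(l - \<sigma>) / 4 * (1 - chain_ratio (l / \<sigma>))\<^sup>2 = (\<sigma> * t\<^sup>2 - \<sigma>) / 4 * (2 / (t + 1))\<^sup>2"
    using l by simp
  also have "\<dots> = \<sigma> * (t\<^sup>2 - 1) / (t + 1)\<^sup>2"
    using \<open>0 \<le> t\<close> by (simp add: power_divide field_simps)
  also have "\<dots> = \<sigma> * chain_ratio (l / \<sigma>)"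
  proof -
    have "t\<^sup>2 - 1 = (t - 1) * (t + 1)" by (simp add: power2_eq_square algebra_simps)
    then show ?thesis
      using \<open>0 \<le> t\<close> by (simp add: chain_ratio_def power2_eq_square flip: t_def)
  qed
  finally show ?thesis .
qed

text \<open>
  All blocks but one have size 1 and contribute \<open>\<sigma> / 2\<close> times a square, so that only the chain
  of block \<open>s\<close> has to be learned. After \<open>k\<close> steps its error is governed by the number of draws of
  \<open>s\<close>. The truncation of the chain to finite length costs the factor \<open>1 / 2\<close>.
\<close>

proposition block_lower_bound:
  fixes G :: "'w algorithm"
  assumes G: "G \<in> async_incremental" and params: "parameter_set \<sigma> L" and s: "s < length L"
    and p: "\<And>l. measure (prob_of G \<sigma> L) {\<omega> \<in> space (prob_of G \<sigma> L). index G \<sigma> L l \<omega> = s} = p"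
  shows "\<exists>ds f xs x0. problem \<sigma> L ds f \<and>
    is_arg_min f (\<lambda>x. x \<in> euclid (sum_list ds)) xs \<and>
    x0 \<in> euclid (sum_list ds) \<and> x0 \<noteq> xs \<and>
    mean_sq_error G \<sigma> L ds f x0 xs k / ennreal ((l2norm (x0 - xs))\<^sup>2)
      \<ge> ennreal (1 / 2 * (1 - p * (1 - (chain_ratio (L ! s / \<sigma>))\<^sup>2)) ^ k)"
proof -
  define q where "q = chain_ratio (L ! s / \<sigma>)"
  have "0 < \<sigma>" "\<sigma> \<le> L ! s" using params s by (auto simp: parameter_set_def)
  then have q: "0 \<le> q" "q < 1" unfolding q_def by (auto intro!: chain_ratio_bounds)
  define a where "a = (L ! s - \<sigma>) / 4"
  have root: "a * (1 - q)\<^sup>2 = \<sigma> * q"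
    unfolding a_def q_def using \<open>0 < \<sigma>\<close> \<open>\<sigma> \<le> L ! s\<close> by (rule chain_ratio_root)
  have "q\<^sup>2 < 1" using q by (simp add: power_less_one_iff)
  then obtain t where t: "(q\<^sup>2) ^ t < 1 / 2" using real_arch_pow_inv[of "1 / 2" "q\<^sup>2"] by auto
  then have "0 < t" by (cases t) auto
  \<comment> \<open>At most \<open>k\<close> coordinates get revealed; the \<open>t\<close> further ones keep at least half of the infinite tail.\<close>
  define m where "m = k + t"
  define ds where "ds = chain_blocks (length L) s m"
  define d where "d = sum_list ds"
  define f where "f = chain_objective d \<sigma> a q s m"
  define c where "c = chain_solution q s m"
  have sm: "s + m \<le> d" by (simp add: d_def ds_def sum_list_chain_blocks)
  have prob: "problem \<sigma> L ds f"
    unfolding f_def d_def ds_def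
    using q \<open>0 < t\<close> by (intro chain_problem params s a_def) (auto simp: m_def)
  have min: "is_arg_min f (\<lambda>x. x \<in> euclid d) c"
    unfolding f_def c_def
  proof (rule quadratic_minimizer[OF chain_hessian_sym _ chain_diagonally_dominant])
    show "0 \<le> a" using \<open>\<sigma> \<le> L ! s\<close> by (simp add: a_def)
  qed (use \<open>0 < \<sigma>\<close> q sm in \<open>auto intro: chain_solution_in_euclid\<close>)
  have zero: "0 \<in> euclid d" by (simp add: euclid_iff)
  define E where "E = (\<Sum>j<m. (q\<^sup>2) ^ j)"
  have E: "(l2norm (0 - c))\<^sup>2 = E" unfolding c_def E_def using sm by (rule l2norm_chain_solution)
  have "(\<Sum>j\<in>{0}. (q\<^sup>2) ^ j) \<le> E"
    unfolding E_def using \<open>0 < t\<close> by (intro sum_mono2) (auto simp: m_def)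
  then have "1 \<le> E" by simp
  have "0 \<noteq> c"
  proof
    assume "0 = c"
    then have "E = 0" using E by (simp add: l2norm_def)
    with \<open>1 \<le> E\<close> show False by simp
  qed
  define M where "M = prob_of G \<sigma> L"
  define I where "I = index G \<sigma> L"
  define X where "X = iterate G \<sigma> L ds f 0"
  let ?N = "\<lambda>\<omega>. card {l. l < k \<and> I l \<omega> = s}"
  from G params prob zero have M: "prob_space M"
    and indep: "prob_space.indep_vars M (\<lambda>_. count_space {..<length L}) I UNIV"
    and X_euclid: "\<And>k \<omega>. \<omega> \<in> space M \<Longrightarrow> X k \<omega> \<in> euclid d"
    and X_0: "\<And>\<omega>. \<omega> \<in> space M \<Longrightarrow> X 0 \<omega> = 0"
    and X_step: "AE \<omega> in M. \<forall>k. incremental_step ds f (\<lambda>j. I j \<omega>) (\<lambda>j. X j \<omega>) k"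
    unfolding M_def I_def X_def d_def
    by (auto simp: async_incremental_def iid_indices_def random_vectors_def)
  interpret prob_space M by (rule M)
  have N_meas: "(\<lambda>\<omega>. ennreal ((q\<^sup>2) ^ ?N \<omega>)) \<in> borel_measurable M"
  proof -
    have "I l \<in> measurable M (count_space {..<length L})" for l
      using indep by (simp add: indep_vars_def)
    then have [measurable]: "I l \<in> measurable M (count_space UNIV)" for l
      by (rule measurable_compose[where g = "\<lambda>i. i"]) simp
    have "?N \<omega> = (\<Sum>l<k. if I l \<omega> = s then 1 else 0)" for \<omega>
      by (simp add: sum.If_cases Collect_conj_eq[symmetric] lessThan_def Int_def)
    then show ?thesis by simp
  qed
  define R where "R = (1 - p * (1 - q\<^sup>2)) ^ k"
  have "ennreal (1 / 2 * R) * ennreal E = ennreal (R * (E / 2))"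
    using \<open>1 \<le> E\<close> by (subst ennreal_mult''[symmetric]) (auto simp: mult.commute)
  also have "\<dots> = ennreal R * ennreal (E / 2)"
    using \<open>1 \<le> E\<close> by (intro ennreal_mult'') auto
  also have "ennreal R = (\<integral>\<^sup>+\<omega>. ennreal ((q\<^sup>2) ^ ?N \<omega>) \<partial>M)"
    unfolding R_def by (rule nn_integral_power_count[OF indep s, symmetric]) (auto simp: M_def I_def p)
  also have "\<dots> * ennreal (E / 2) = (\<integral>\<^sup>+\<omega>. ennreal ((q\<^sup>2) ^ ?N \<omega>) * ennreal (E / 2) \<partial>M)"
    by (rule nn_integral_multc[OF N_meas, symmetric])
  also have "\<dots> \<le> (\<integral>\<^sup>+\<omega>. ennreal ((l2norm (X k \<omega> - c))\<^sup>2) \<partial>M)"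
  proof (rule nn_integral_mono_AE, use X_step AE_space in eventually_elim)
    fix \<omega> assume step: "\<forall>k. incremental_step ds f (\<lambda>j. I j \<omega>) (\<lambda>j. X j \<omega>) k" and "\<omega> \<in> space M"
    have "X k \<omega> \<in> supported_below s m (?N \<omega>)"
      using step X_0[OF \<open>\<omega> \<in> space M\<close>] unfolding ds_def f_def d_def
      by (intro iterate_supported_below[OF root, where x = "\<lambda>j. X j \<omega>"]) auto
    then have "(\<Sum>j\<in>{?N \<omega>..<m}. (q\<^sup>2) ^ j) \<le> (l2norm (X k \<omega> - c))\<^sup>2"
      unfolding c_def by (intro chain_error_ge[OF sm X_euclid[OF \<open>\<omega> \<in> space M\<close>]])
    moreover have "?N \<omega> \<le> k"
      using card_mono[of "{..<k}" "{l. l < k \<and> I l \<omega> = s}"] by auto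
    then have "(q\<^sup>2) ^ ?N \<omega> * E \<le> 2 * (\<Sum>j\<in>{?N \<omega>..<m}. (q\<^sup>2) ^ j)"
      unfolding E_def using \<open>q\<^sup>2 < 1\<close> t \<open>0 < t\<close>
      by (intro geometric_tail_ge_half[of _ _ k]) (auto simp: m_def)
    ultimately have "(q\<^sup>2) ^ ?N \<omega> * (E / 2) \<le> (l2norm (X k \<omega> - c))\<^sup>2" by simp
    moreover have "ennreal ((q\<^sup>2) ^ ?N \<omega>) * ennreal (E / 2) = ennreal ((q\<^sup>2) ^ ?N \<omega> * (E / 2))"
      using \<open>1 \<le> E\<close> by (intro ennreal_mult''[symmetric]) auto
    ultimately show "ennreal ((q\<^sup>2) ^ ?N \<omega>) * ennreal (E / 2) \<le> ennreal ((l2norm (X k \<omega> - c))\<^sup>2)"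
      by (simp only: ennreal_leI)
  qed
  also have "\<dots> = mean_sq_error G \<sigma> L ds f 0 c k"
    by (simp add: mean_sq_error_def M_def X_def)
  finally have "ennreal (1 / 2 * R) * ennreal E / ennreal E
      \<le> mean_sq_error G \<sigma> L ds f 0 c k / ennreal E"
    by (rule divide_right_mono_ennreal)
  also have "ennreal (1 / 2 * R) * ennreal E / ennreal E = ennreal (1 / 2 * R)"
    using \<open>1 \<le> E\<close> by (intro ennreal_mult_divide_eq) auto
  finally show ?thesis
    using prob min zero \<open>0 \<noteq> c\<close> unfolding q_def[symmetric] R_def E[symmetric] d_def by blast
qed

section \<open>The best block\<close>

lemma cond_sum_ge:
  assumes "parameter_set \<sigma> L"
  shows "3 * real (length L) \<le> cond_sum \<sigma> L"
proof -
  have "(\<Sum>i<length L. 1) \<le> (\<Sum>i<length L. sqrt (L ! i / \<sigma>))"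
    using assms by (intro sum_mono) (auto simp: parameter_set_def)
  then show ?thesis by (simp add: cond_sum_def)
qed

text \<open>
  The probabilities \<open>p i\<close> cannot all exceed the shares \<open>(sqrt (L ! i / \<sigma>) + 2) / cond_sum \<sigma> L\<close>,
  since both sum to 1. For a block drawn no more often than its share, write
  \<open>t = sqrt (L ! s / \<sigma>)\<close>; then \<open>1 - q\<^sup>2 = 4 * t / (t + 1)\<^sup>2 \<le> 4 / (t + 2)\<close> for the ratio \<open>q\<close> of its
  chain, and the share cancels the denominator \<open>t + 2\<close>.
\<close>

lemma exists_slow_block:
  assumes params: "parameter_set \<sigma> L" and p: "(\<Sum>i<length L. p i) = 1"
  obtains s where "s < length L"
    "1 - 4 / cond_sum \<sigma> L \<le> 1 - p s * (1 - (chain_ratio (L ! s / \<sigma>))\<^sup>2)"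
proof -
  let ?C = "cond_sum \<sigma> L" and ?t = "\<lambda>i. sqrt (L ! i / \<sigma>)"
  have "L \<noteq> []" using params by (simp add: parameter_set_def)
  then have "0 < ?C" using cond_sum_ge[OF params] by (cases L) auto
  have "\<exists>s<length L. p s * ?C \<le> ?t s + 2"
  proof (rule ccontr)
    assume "\<not> ?thesis"
    then have "(\<Sum>i<length L. ?t i + 2) < (\<Sum>i<length L. p i * ?C)"
      using \<open>L \<noteq> []\<close> by (intro sum_strict_mono) (auto simp: not_le)
    also have "\<dots> = ?C" using p by (simp flip: sum_distrib_right)
    finally show False by (simp add: cond_sum_def sum.distrib)
  qed
  then obtain s where s: "s < length L" and share: "p s \<le> (?t s + 2) / ?C"
    using \<open>0 < ?C\<close> by (auto simp: pos_le_divide_eq)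
  define t where "t = ?t s"
  have "1 \<le> t" using params s by (simp add: t_def parameter_set_def)
  define w where "w = 1 - (chain_ratio (L ! s / \<sigma>))\<^sup>2"
  have w: "w = 4 * t / (t + 1)\<^sup>2"
    unfolding w_def chain_ratio_def t_def[symmetric] using \<open>1 \<le> t\<close>
    by (simp add: power_divide divide_simps) (simp add: power2_eq_square algebra_simps)
  have "p s * w \<le> (t + 2) / ?C * w"
    using share \<open>1 \<le> t\<close> by (intro mult_right_mono) (auto simp: t_def[symmetric] w)
  also have "\<dots> = (t + 2) * w / ?C" by simp
  also have "\<dots> \<le> 4 / ?C"
  proof (rule divide_right_mono)
    have "(t + 2) * (4 * t) \<le> 4 * (t + 1)\<^sup>2"
      by (simp add: power2_eq_square algebra_simps)
    then show "(t + 2) * w \<le> 4"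
      using \<open>1 \<le> t\<close> by (simp add: w pos_divide_le_eq)
  qed (use \<open>0 < ?C\<close> in simp)
  finally show ?thesis using that[OF s] by (simp add: w_def)
qed

text \<open>
  Taking the \<open>k\<close>-th power is monotone only for a nonnegative base, and odd powers of a negative
  base are negative. A negative base forces \<open>n = 1\<close>, so that the only block is drawn in every
  step and the contraction factor is \<open>q\<^sup>2\<close>. For even \<open>k > 0\<close> it has to dominate the absolute value
  of the base, which for \<open>t = sqrt (L ! 0 / \<sigma>)\<close> amounts to \<open>t\<^sup>2 \<ge> 3\<close>.
\<close>

lemma contraction_power_ge:
  assumes params: "parameter_set \<sigma> L" and nondeg: "\<not> sign_degenerate \<sigma> L k"
    and p: "(\<Sum>i<length L. p i) = 1" and s: "s < length L"
    and ge: "1 - 4 / cond_sum \<sigma> L \<le> 1 - p s * (1 - (chain_ratio (L ! s / \<sigma>))\<^sup>2)"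
  shows "(1 - 4 / cond_sum \<sigma> L) ^ k \<le> max 0 ((1 - p s * (1 - (chain_ratio (L ! s / \<sigma>))\<^sup>2)) ^ k)"
proof -
  let ?b = "1 - 4 / cond_sum \<sigma> L" and ?g = "1 - p s * (1 - (chain_ratio (L ! s / \<sigma>))\<^sup>2)"
  consider "0 \<le> ?b" | "odd k" "?b < 0" | "k = 0" | "even k" "0 < k" "?b < 0" by fastforce
  then show ?thesis
  proof cases
    case 1
    then have "?b ^ k \<le> ?g ^ k" using ge by (intro power_mono) auto
    then show ?thesis by simp
  next
    case 2
    then have "?b ^ k \<le> 0" by (simp add: power_less_zero_eq less_imp_le)
    then show ?thesis by simp
  next
    case 4
    have "L \<noteq> []" using params by (simp add: parameter_set_def)
    then have "0 < cond_sum \<sigma> L" using cond_sum_ge[OF params] by (cases L) auto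
    with 4 have "cond_sum \<sigma> L < 4" by (simp add: pos_less_divide_eq)
    with cond_sum_ge[OF params] have "real (length L) < 2" by linarith
    with \<open>L \<noteq> []\<close> have n: "length L = 1" by (cases L) auto
    with s have "s = 0" by simp
    have "0 < \<sigma>" "\<sigma> \<le> L ! 0" using params n by (auto simp: parameter_set_def)
    define t where "t = sqrt (L ! 0 / \<sigma>)"
    have "3 * \<sigma> \<le> L ! 0" using nondeg n 4 by (simp add: sign_degenerate_def)
    then have t2: "3 \<le> t\<^sup>2" using \<open>0 < \<sigma>\<close> \<open>\<sigma> \<le> L ! 0\<close> by (simp add: t_def pos_le_divide_eq)
    have "0 \<le> t" using \<open>0 < \<sigma>\<close> \<open>\<sigma> \<le> L ! 0\<close> by (simp add: t_def)
    have C: "cond_sum \<sigma> L = t + 2" by (simp add: cond_sum_def n t_def)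
    have g: "?g = ((t - 1) / (t + 1))\<^sup>2"
      using p n \<open>s = 0\<close> by (simp add: chain_ratio_def t_def)
    have "0 \<le> 2 * t * (t\<^sup>2 - 3)" using t2 \<open>0 \<le> t\<close> by simp
    then have "(2 - t) * (t + 1)\<^sup>2 \<le> (t - 1)\<^sup>2 * (t + 2)"
      by (simp add: power2_eq_square algebra_simps)
    then have "(2 - t) / (t + 2) \<le> (t - 1)\<^sup>2 / (t + 1)\<^sup>2"
      using \<open>0 \<le> t\<close> by (subst frac_le_eq) (auto simp: divide_simps)
    moreover have "- ?b = (2 - t) / (t + 2)"
      using \<open>0 \<le> t\<close> by (simp add: C field_simps)
    ultimately have "- ?b \<le> ?g" by (simp add: g power_divide)
    then have "(- ?b) ^ k \<le> ?g ^ k" using 4 by (intro power_mono) auto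
    moreover have "(- ?b) ^ k = ?b ^ k"
      using \<open>even k\<close> by (simp only: uminus_power_if if_True)
    ultimately show ?thesis by simp
  qed simp
qed

theorem error_lower_bound:
  fixes G :: "'w algorithm"
  assumes G: "G \<in> async_incremental" and params: "parameter_set \<sigma> L"
    and nondeg: "\<not> sign_degenerate \<sigma> L k"
  shows "\<exists>ds f xs x0. problem \<sigma> L ds f \<and>
    is_arg_min f (\<lambda>x. x \<in> euclid (sum_list ds)) xs \<and>
    x0 \<in> euclid (sum_list ds) \<and> x0 \<noteq> xs \<and>
    mean_sq_error G \<sigma> L ds f x0 xs k / ennreal ((l2norm (x0 - xs))\<^sup>2)
      \<ge> ennreal (1 / 2 * (1 - 4 / cond_sum \<sigma> L) ^ k)"
proof -
  have "iid_indices (prob_of G \<sigma> L) (length L) (index G \<sigma> L)"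
    using G params by (simp add: async_incremental_def)
  then obtain p where p: "(\<Sum>i<length L. p i) = 1"
    and p_eq: "\<And>l i. i < length L \<Longrightarrow>
      measure (prob_of G \<sigma> L) {\<omega> \<in> space (prob_of G \<sigma> L). index G \<sigma> L l \<omega> = i} = p i"
    by (auto simp: iid_indices_def)
  obtain s where s: "s < length L"
    and ge: "1 - 4 / cond_sum \<sigma> L \<le> 1 - p s * (1 - (chain_ratio (L ! s / \<sigma>))\<^sup>2)"
    using exists_slow_block[OF params p] .
  have "1 / 2 * (1 - 4 / cond_sum \<sigma> L) ^ k
      \<le> max 0 (1 / 2 * (1 - p s * (1 - (chain_ratio (L ! s / \<sigma>))\<^sup>2)) ^ k)"
    using contraction_power_ge[OF params nondeg p s ge] by (auto simp: max_def split: if_splits)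
  then have "ennreal (1 / 2 * (1 - 4 / cond_sum \<sigma> L) ^ k)
      \<le> ennreal (1 / 2 * (1 - p s * (1 - (chain_ratio (L ! s / \<sigma>))\<^sup>2)) ^ k)"
    by (metis ennreal_leI ennreal_max_0)
  then show ?thesis
    using block_lower_bound[OF G params s p_eq[OF s], of k] by (meson order_trans)
qed

section \<open>The complexity\<close>

text \<open>
  If \<open>K\<close> iterations guarantee accuracy \<open>\<epsilon>\<close>, then \<open>(1 - 4 / S) ^ K / 2 \<le> \<epsilon>\<close>, that is,
  \<open>K \<ge> ln (1 / (2 * \<epsilon>)) / - ln (1 - 4 / S)\<close>. The correction is the \<open>\<delta>\<close> that turns the right-hand
  side into \<open>1 / 4 * (1 + \<delta>) * S * ln (1 / (2 * \<epsilon>))\<close>. For \<open>S \<le> 4\<close>, where \<open>1 - 4 / S\<close> has no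
  logarithm, the value \<open>- 1\<close> makes the claimed bound \<open>K \<ge> 0\<close>.
\<close>

definition rate_correction :: "real \<Rightarrow> real" where
  "rate_correction S = (if 4 < S then 4 / (S * - ln (1 - 4 / S)) - 1 else - 1)"

lemma rate_correction_tendsto_0: "rate_correction \<in> o[at_top](\<lambda>_. 1)"
proof -
  have "((\<lambda>S :: real. 4 / (S * - ln (1 - 4 / S)) - 1) \<longlongrightarrow> 0) at_top"
    by real_asymp
  moreover have "\<forall>\<^sub>F S in at_top. 4 / (S * - ln (1 - 4 / S)) - 1 = rate_correction S"
    using eventually_gt_at_top[of 4] by eventually_elim (simp add: rate_correction_def)
  ultimately have "(rate_correction \<longlongrightarrow> 0) at_top"
    by (rule Lim_transform_eventually)
  then show ?thesis by (intro smalloI_tendsto) auto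
qed

lemma iterations_lower_bound:
  fixes G :: "'w algorithm"
  assumes G: "G \<in> async_incremental" and params: "parameter_set \<sigma> L" and "0 < \<epsilon>"
    and K: "\<And>ds f xs x0. problem \<sigma> L ds f \<Longrightarrow> is_arg_min f (\<lambda>x. x \<in> euclid (sum_list ds)) xs \<Longrightarrow>
      x0 \<in> euclid (sum_list ds) \<Longrightarrow>
      mean_sq_error G \<sigma> L ds f x0 xs K \<le> ennreal (\<epsilon> * (l2norm (x0 - xs))\<^sup>2)"
  shows "1 / 4 * (1 + rate_correction (cond_sum \<sigma> L)) * cond_sum \<sigma> L * ln (1 / (2 * \<epsilon>)) \<le> real K"
proof (cases "4 < cond_sum \<sigma> L")
  case True
  define S where "S = cond_sum \<sigma> L"
  have "4 < S" using True by (simp add: S_def)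
  \<comment> \<open>In the degenerate case \<open>S = sqrt (L ! 0 / \<sigma>) + 2\<close> is less than 4.\<close>
  have "\<not> sign_degenerate \<sigma> L K"
  proof
    assume deg: "sign_degenerate \<sigma> L K"
    then have "0 < \<sigma>" "length L = 1" "L ! 0 / \<sigma> \<le> 3"
      using params by (auto simp: sign_degenerate_def parameter_set_def pos_divide_le_eq)
    then have "sqrt (L ! 0 / \<sigma>) \<le> sqrt (2\<^sup>2)" by (intro real_sqrt_le_mono) simp
    then show False using True \<open>length L = 1\<close> by (simp add: cond_sum_def)
  qed
  from error_lower_bound[OF G params this] obtain ds f xs x0 where
    inst: "problem \<sigma> L ds f" "is_arg_min f (\<lambda>x. x \<in> euclid (sum_list ds)) xs"
      "x0 \<in> euclid (sum_list ds)" "x0 \<noteq> xs"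
    and ge: "ennreal (1 / 2 * (1 - 4 / S) ^ K)
      \<le> mean_sq_error G \<sigma> L ds f x0 xs K / ennreal ((l2norm (x0 - xs))\<^sup>2)"
    unfolding S_def by blast
  obtain j where "lookup x0 j \<noteq> lookup xs j"
    using inst(4) poly_mapping_eqI[of x0 xs] by auto
  then have "j \<in> Poly_Mapping.keys (x0 - xs)" by (simp add: in_keys_iff lookup_minus)
  then have "l2norm (x0 - xs) \<noteq> 0"
    by (auto simp: l2norm_def L2_set_eq_0_iff in_keys_iff)
  then have "0 < (l2norm (x0 - xs))\<^sup>2" by simp
  have "ennreal (1 / 2 * (1 - 4 / S) ^ K)
      \<le> ennreal (\<epsilon> * (l2norm (x0 - xs))\<^sup>2) / ennreal ((l2norm (x0 - xs))\<^sup>2)"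
    using ge divide_right_mono_ennreal[OF K[OF inst(1-3)]] by (rule order_trans)
  also have "\<dots> = ennreal \<epsilon>"
    using \<open>0 < (l2norm (x0 - xs))\<^sup>2\<close> \<open>0 < \<epsilon>\<close> by (subst divide_ennreal) auto
  finally have "(1 - 4 / S) ^ K \<le> 2 * \<epsilon>" using \<open>0 < \<epsilon>\<close> by simp
  moreover have "0 < 1 - 4 / S" "1 - 4 / S < 1" using \<open>4 < S\<close> by auto
  ultimately have "ln ((1 - 4 / S) ^ K) \<le> ln (2 * \<epsilon>)"
    using \<open>0 < \<epsilon>\<close> by (subst ln_le_cancel_iff) auto
  then have "ln (1 / (2 * \<epsilon>)) \<le> real K * - ln (1 - 4 / S)"
    using \<open>0 < 1 - 4 / S\<close> \<open>0 < \<epsilon>\<close> by (simp add: ln_realpow ln_div)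
  moreover have "0 < - ln (1 - 4 / S)"
    using \<open>0 < 1 - 4 / S\<close> \<open>1 - 4 / S < 1\<close> by simp
  ultimately have "ln (1 / (2 * \<epsilon>)) / - ln (1 - 4 / S) \<le> real K"
    by (simp only: pos_divide_le_eq)
  moreover have "1 / 4 * (1 + rate_correction S) * S * ln (1 / (2 * \<epsilon>))
      = ln (1 / (2 * \<epsilon>)) / - ln (1 - 4 / S)"
    using \<open>4 < S\<close> by (simp add: rate_correction_def)
  ultimately show ?thesis by (simp add: S_def)
qed (simp add: rate_correction_def)

theorem theorem2:
  shows "(\<forall>G \<in> (async_incremental :: 'w algorithm set). \<forall>\<sigma> L k.
            parameter_set \<sigma> L \<longrightarrow> \<not> sign_degenerate \<sigma> L k \<longrightarrow>
            (\<exists>ds f xs x0. problem \<sigma> L ds f \<and>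
               is_arg_min f (\<lambda>x. x \<in> euclid (sum_list ds)) xs \<and>
               x0 \<in> euclid (sum_list ds) \<and> x0 \<noteq> xs \<and>
               mean_sq_error G \<sigma> L ds f x0 xs k / ennreal ((l2norm (x0 - xs))\<^sup>2)
                 \<ge> ennreal (1 / 2 * (1 - 4 / cond_sum \<sigma> L) ^ k))) \<and>
         (\<exists>\<delta>. \<delta> \<in> o[at_top](\<lambda>_. 1) \<and>
            (\<forall>G \<in> (async_incremental :: 'w algorithm set). \<forall>\<sigma> L \<epsilon>.
               parameter_set \<sigma> L \<longrightarrow> 0 < \<epsilon> \<longrightarrow>
               ereal_of_enat (complexity G \<sigma> L \<epsilon>)
                 \<ge> ereal (1 / 4 * (1 + \<delta> (cond_sum \<sigma> L)) * cond_sum \<sigma> L * ln (1 / (2 * \<epsilon>)))))"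
proof (intro conjI ballI allI impI)
  fix G :: "'w algorithm" and \<sigma> L k
  assume "G \<in> async_incremental" "parameter_set \<sigma> L" "\<not> sign_degenerate \<sigma> L k"
  then show "\<exists>ds f xs x0. problem \<sigma> L ds f \<and>
      is_arg_min f (\<lambda>x. x \<in> euclid (sum_list ds)) xs \<and>
      x0 \<in> euclid (sum_list ds) \<and> x0 \<noteq> xs \<and>
      mean_sq_error G \<sigma> L ds f x0 xs k / ennreal ((l2norm (x0 - xs))\<^sup>2)
        \<ge> ennreal (1 / 2 * (1 - 4 / cond_sum \<sigma> L) ^ k)"
    by (rule error_lower_bound)
next
  show "\<exists>\<delta>. \<delta> \<in> o[at_top](\<lambda>_. 1) \<and>
      (\<forall>G \<in> (async_incremental :: 'w algorithm set). \<forall>\<sigma> L \<epsilon>. parameter_set \<sigma> L \<longrightarrow> 0 < \<epsilon> \<longrightarrow>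
        ereal_of_enat (complexity G \<sigma> L \<epsilon>)
          \<ge> ereal (1 / 4 * (1 + \<delta> (cond_sum \<sigma> L)) * cond_sum \<sigma> L * ln (1 / (2 * \<epsilon>))))"
  proof (intro exI conjI ballI allI impI)
    show "rate_correction \<in> o[at_top](\<lambda>_. 1)"
      by (rule rate_correction_tendsto_0)
    fix G :: "'w algorithm" and \<sigma> L and \<epsilon> :: real
    assume GL: "G \<in> async_incremental" "parameter_set \<sigma> L" "0 < \<epsilon>"
    show "ereal (1 / 4 * (1 + rate_correction (cond_sum \<sigma> L)) * cond_sum \<sigma> L * ln (1 / (2 * \<epsilon>)))
      \<le> ereal_of_enat (complexity G \<sigma> L \<epsilon>)"
    proof (cases "complexity G \<sigma> L \<epsilon>")
      case (enat K)
      let ?Ks = "{K. \<forall>ds f xs x0. problem \<sigma> L ds f \<longrightarrow> is_arg_min f (\<lambda>x. x \<in> euclid (sum_list ds)) xs \<longrightarrow>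
        x0 \<in> euclid (sum_list ds) \<longrightarrow>
        mean_sq_error G \<sigma> L ds f x0 xs K \<le> ennreal (\<epsilon> * (l2norm (x0 - xs))\<^sup>2)}"
      have K: "enat K = Inf (enat ` ?Ks)"
        using enat by (simp add: complexity_def)
      have "?Ks \<noteq> {}"
      proof
        assume "?Ks = {}"
        with K have "enat K = Inf {}" by (simp only: image_empty)
        then show False by (simp add: top_enat_def)
      qed
      then have "Inf (enat ` ?Ks) \<in> enat ` ?Ks"
        by (blast intro: wellorder_InfI)
      then have "K \<in> ?Ks" unfolding K[symmetric] by blast
      then show ?thesis
        unfolding enat ereal_of_enat_simps ereal_less_eq
        by (intro iterations_lower_bound[OF GL]) auto
    qed simp
  qed
qed

end
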